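(* Let $\alpha_1,\alpha_2>0$. The sumset $\{2^{-n^{\alpha_1}}:n\ge1\}+\{2^{-n^{\alpha_2}}:n\ge1\}$ is not measure universal whenever $$\frac{1}{\alpha_1}+\frac{1}{\alpha_2}>1.$$ (This contains every pair $\alpha_1,\alpha_2\in(0,2)$, in particular the symmetric range $\alpha_1=\alpha_2\in(0,2)$, and also pairs such as $\alpha_1=6/5$, $\alpha_2=5$.) Moreover, if $\alpha_1\le1$, then $\{2^{-n^{\alpha_1}}:n\ge1\}+A$ is not measure universal for every infinite set $A\subset\mathbb{R}$.
   Context: A set $E\subset\mathbb{R}$ is measure universal if for every Lebesgue measurable $L\subset\mathbb{R}$ of positive Lebesgue measure there exist $x\in\mathbb{R}$ and $\lambda\neq0$ with $x+\lambda E\subset L$. For sets $X,Y\subset\mathbb{R}$, $X+Y=\{x+y: x\in X,\ y\in Y\}$. *)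

theory Defs
  imports "HOL-Analysis.Analysis" "HOL-Library.Set_Algebras"
begin

definition measure_universal :: "real set \<Rightarrow> bool" where
  "measure_universal E \<longleftrightarrow>
    (\<forall>L \<in> sets lebesgue. emeasure lebesgue L > 0 \<longrightarrow>
      (\<exists>x c. c \<noteq> 0 \<and> (\<lambda>e. x + c * e) ` E \<subseteq> L))"

definition pow_seq_set :: "real \<Rightarrow> real set" where
  "pow_seq_set \<alpha> = {2 powr (- (real n powr \<alpha>)) | n :: nat. n \<ge> 1}"

end

theory Submission
  imports Defs
begin

text \<open>
  If, for every \<open>\<epsilon> > 0\<close>, a bounded set contains arbitrarily large finite subsets of \<open>n\<close> points
  with mutual distances at least \<open>exp (- \<epsilon> n)\<close>, then it is not measure universal (Kolountzakis).
  Indeed, cut \<open>[0,1)\<close> into \<open>M \<approx> exp (\<epsilon> n)\<close> cells. Up to an error of a few cells, the affine copies of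
  the \<open>n\<close> points with dilation factor in \<open>[1/k, k]\<close> yield only \<open>O(M\<^sup>2)\<close> sets of \<open>n\<close> cells, so
  deleting \<open>O(M ln M / n) = O(\<epsilon> M)\<close> cells meets all of them. Intersecting over \<open>k\<close> treats all
  dilations at once.

  For exponents \<open>\<alpha>, \<beta> \<ge> 1\<close>, the sums of about \<open>T powr (1/\<alpha>)\<close> points of the first sequence
  and, at a smaller scale, \<open>T powr (1/\<beta>)\<close> points of the second are separated by \<open>exp (- O(T))\<close>,
  and \<open>1/\<alpha> + 1/\<beta> > 1\<close> makes this subexponential in their number. For \<open>\<alpha> \<le> 1\<close>, a sparse
  subsequence behaves like \<open>4\<^sup>-\<^sup>k\<close>, and adding \<open>K\<close> fixed points of \<open>A\<close> multiplies the number
  of points by \<open>K\<close> while the separation stays \<open>exp (- O(M))\<close> for \<open>M\<close> terms.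
\<close>

section \<open>Small hitting sets for finite families\<close>

text \<open>By double counting, some element of \<open>S\<close> lies in at least the fraction
  \<open>n / card S\<close> of the members of \<open>F\<close> that \<open>D\<close> has not met
  yet. Each greedy choice thus shrinks the unmet family by the factor
  \<open>1 - n / card S\<close>.\<close>

lemma greedy_hitting:
  fixes S :: "'a set" and n k :: nat
  assumes "finite S" "S \<noteq> {}" "finite F" "n \<le> card S"
    and F: "\<And>P. P \<in> F \<Longrightarrow> P \<subseteq> S \<and> n \<le> card P"
  shows "\<exists>D\<subseteq>S. card D \<le> k \<and>
    real (card {P\<in>F. P \<inter> D = {}}) \<le> real (card F) * (1 - real n / real (card S)) ^ k"
proof (induction k)
  case 0
  show ?case by (rule exI[of _ "{}"]) simp
next
  case (Suc k)
  let ?r = "1 - real n / real (card S)"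
  from Suc obtain D where D: "D \<subseteq> S" "card D \<le> k"
    "real (card {P\<in>F. P \<inter> D = {}}) \<le> real (card F) * ?r ^ k" by blast
  define G where "G = {P\<in>F. P \<inter> D = {}}"
  have G: "finite G" using assms by (simp add: G_def)
  have cS: "card S > 0" using assms by (simp add: card_gt_0_iff)
  have "(\<Sum>s\<in>S. card {P\<in>G. s \<in> P}) = (\<Sum>P\<in>G. card {s\<in>S. s \<in> P})"
    by (rule sum_multicount_gen) (use assms G in auto)
  also have "\<dots> \<ge> (\<Sum>P\<in>G. n)"
  proof (rule sum_mono)
    fix P assume "P \<in> G"
    then have "P \<in> F" by (simp add: G_def)
    with F have "{s\<in>S. s \<in> P} = P" "n \<le> card P" by auto
    then show "n \<le> card {s\<in>S. s \<in> P}" by simp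
  qed
  finally have sum: "n * card G \<le> (\<Sum>s\<in>S. card {P\<in>G. s \<in> P})" by (simp add: mult.commute)
  obtain s where s: "s \<in> S" "real n / real (card S) * real (card G) \<le> real (card {P\<in>G. s \<in> P})"
  proof (rule ccontr)
    assume "\<not> thesis"
    with that have "\<And>s. s \<in> S \<Longrightarrow>
      real (card {P\<in>G. s \<in> P}) < real n / real (card S) * real (card G)" by fastforce
    then have "(\<Sum>s\<in>S. real (card {P\<in>G. s \<in> P})) <
        (\<Sum>s\<in>S. real n / real (card S) * real (card G))"
      by (intro sum_strict_mono assms)
    also have "\<dots> = real (n * card G)" using cS by simp
    finally have "(\<Sum>s\<in>S. card {P\<in>G. s \<in> P}) < n * card G"
      by (metis (no_types, lifting) of_nat_less_iff of_nat_sum sum.cong)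
    with sum show False by simp
  qed
  have eq: "{P\<in>F. P \<inter> insert s D = {}} = G - {P\<in>G. s \<in> P}" by (auto simp: G_def)
  have sub: "{P\<in>G. s \<in> P} \<subseteq> G" by auto
  have "real (card {P\<in>F. P \<inter> insert s D = {}}) = real (card G) - real (card {P\<in>G. s \<in> P})"
    unfolding eq using card_Diff_subset[OF finite_subset[OF sub G] sub] card_mono[OF G sub]
    by (simp add: of_nat_diff)
  also have "\<dots> \<le> ?r * real (card G)" using s by (simp add: algebra_simps)
  also have "\<dots> \<le> ?r * (real (card F) * ?r ^ k)"
    using D cS assms(4) by (intro mult_left_mono) (auto simp: G_def)
  finally have "real (card {P\<in>F. P \<inter> insert s D = {}}) \<le> real (card F) * ?r ^ Suc k"
    by (simp add: mult_ac)
  moreover have "card (insert s D) \<le> Suc k"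
    using D(2) finite_subset[OF D(1) assms(1)] by (simp add: card_insert_if)
  ultimately show ?case using D s by (intro exI[of _ "insert s D"]) auto
qed

lemma small_hitting_set:
  fixes S :: "'a set" and n :: nat and N :: real
  assumes "finite S" "finite F" "n > 0" "n \<le> card S" "real (card F) \<le> N" "N \<ge> 1"
    and F: "\<And>P. P \<in> F \<Longrightarrow> P \<subseteq> S \<and> n \<le> card P"
  shows "\<exists>D\<subseteq>S. real (card D) \<le> real (card S) / real n * ln N + 1 \<and> (\<forall>P\<in>F. P \<inter> D \<noteq> {})"
proof -
  let ?c = "real n / real (card S)"
  \<comment> \<open>The number of steps lies strictly above the threshold, so fewer than one set,
    hence none, stays unmet. The price of \<open>Suc\<close> is the \<open>+ 1\<close> in the
    bound.\<close>
  define k where "k = Suc (nat \<lfloor>real (card S) / real n * ln N\<rfloor>)"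
  have cS: "card S > 0" using assms by linarith
  have nn: "real (card S) / real n * ln N \<ge> 0" using assms by simp
  have k: "real k > real (card S) / real n * ln N" "real k \<le> real (card S) / real n * ln N + 1"
    unfolding k_def using nn by linarith+
  have Sne: "S \<noteq> {}" using cS by auto
  from greedy_hitting[OF assms(1) Sne assms(2,4) F, of k]
  obtain D where D: "D \<subseteq> S" "card D \<le> k"
    "real (card {P\<in>F. P \<inter> D = {}}) \<le> real (card F) * (1 - ?c) ^ k" by blast
  have "(1 - ?c) ^ k \<le> exp (- ?c) ^ k"
    using assms cS exp_ge_add_one_self[of "- ?c"] by (intro power_mono) auto
  also have "\<dots> = exp (- (real k * ?c))" by (simp add: exp_of_nat_mult[symmetric])
  also have "\<dots> < exp (- ln N)"
    using k(1) assms(3) cS by (simp add: field_simps)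
  also have "\<dots> = 1 / N" using assms by (simp add: exp_minus field_simps)
  finally have "(1 - ?c) ^ k < 1 / N" .
  moreover have "(1 - ?c) ^ k \<ge> 0" using assms cS by simp
  ultimately have "real (card F) * (1 - ?c) ^ k < 1"
    using mult_mono[of "real (card F)" N "(1 - ?c) ^ k" "(1 - ?c) ^ k"] assms(5,6)
    by (simp add: field_simps)
  with D(3) have "card {P\<in>F. P \<inter> D = {}} = 0" by linarith
  then have "{P\<in>F. P \<inter> D = {}} = {}" using assms by simp
  then show ?thesis using D k by (intro exI[of _ D]) (auto intro: order_trans[of "real (card D)" "real k"])
qed

section \<open>Deleting all copies of a finite separated set\<close>

lemma avoiding_set:
  fixes F :: "real set" and k M R :: nat and g :: real
  assumes fin: "finite F" and ne: "F \<noteq> {}" and k: "k > 0" and R: "R > 0" and g: "g > 0"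
    and FR: "\<And>a. a \<in> F \<Longrightarrow> \<bar>a\<bar> \<le> real R"
    and gap: "\<And>a b. a \<in> F \<Longrightarrow> b \<in> F \<Longrightarrow> a \<noteq> b \<Longrightarrow> g \<le> \<bar>a - b\<bar>"
    and M: "real M \<ge> real k * (1 / g + 1)" "M \<ge> card F"
  shows "\<exists>E. E \<in> sets lebesgue \<and> E \<subseteq> {0..<1} \<and>
    emeasure lebesgue ({0..<1} - E) \<le> ennreal (5 / real M * ((real M + 4) / real (card F) *
       ln (real ((2 * k * M * R + 3) * (2 * M * (1 + k * R) + 3))) + 1)) \<and>
    (\<forall>x t. 1 / real k \<le> \<bar>t\<bar> \<and> \<bar>t\<bar> \<le> real k \<longrightarrow> \<not> (\<lambda>a. x + t * a) ` F \<subseteq> E)"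
proof -
  \<comment> \<open>After rounding \<open>x\<close> to \<open>i / M\<close> and \<open>t\<close> to \<open>j / (M R)\<close>, the point \<open>x + t a\<close> lies in cell
    \<open>i + \<lfloor>j a / R\<rfloor>\<close>, with an error of at most two cells; hence five cells are deleted around each
    element of a hitting set.\<close>
  define pat where "pat = (\<lambda>i j. (\<lambda>a. i + \<lfloor>real_of_int j * a / real R\<rfloor>) ` F)"
  \<comment> \<open>The margin of two cells on each side of \<open>0..M - 1\<close> absorbs the
    rounding error.\<close>
  define S where "S = {-2..int M + 1}"
  define I where "I = {-int (M * (1 + k * R) + 1)..int (M * (1 + k * R) + 1)}"
  define J where "J = {-int (k * M * R + 1)..int (k * M * R + 1)}"
  \<comment> \<open>Only patterns that stay in \<open>S\<close> and keep at least
    \<open>card F\<close> cells are collected, as the hitting lemma demands. The pattern of a copy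
    contained in \<open>E\<close> will turn out to be one of them.\<close>
  define \<F> where "\<F> = {P. P \<subseteq> S \<and> card F \<le> card P \<and> (\<exists>i\<in>I. \<exists>j\<in>J. P = pat i j)}"
  define N where "N = (2 * k * M * R + 3) * (2 * M * (1 + k * R) + 3)"
  have M0: "M > 0" using M(2) fin ne by (metis card_gt_0_iff le_zero_eq neq0_conv)
  have cF: "card F > 0" using fin ne by (simp add: card_gt_0_iff)
  have cS: "card S = M + 4" by (simp add: S_def)
  have sub: "\<F> \<subseteq> (\<lambda>(i,j). pat i j) ` (I \<times> J)" by (auto simp: \<F>_def)
  have finF: "finite \<F>" by (rule finite_subset[OF sub]) (simp add: I_def J_def)
  have "card \<F> \<le> card (I \<times> J)"
    by (rule surj_card_le[OF _ sub]) (simp add: I_def J_def)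
  also have "\<dots> = N"
    by (simp add: card_cartesian_product I_def J_def N_def nat_add_distrib nat_mult_distrib algebra_simps)
  finally have cN: "real (card \<F>) \<le> real N" by simp
  have "N \<ge> 1" by (simp add: N_def)
  then have N1: "real N \<ge> 1" by linarith
  have finS: "finite S" by (simp add: S_def)
  have FS: "card F \<le> card S" using M(2) cS by simp
  have PS: "P \<subseteq> S \<and> card F \<le> card P" if "P \<in> \<F>" for P using that by (simp add: \<F>_def)
  obtain D where D: "D \<subseteq> S" "real (card D) \<le> (real M + 4) / real (card F) * ln (real N) + 1"
     "\<forall>P\<in>\<F>. P \<inter> D \<noteq> {}"
    using small_hitting_set[OF finS finF cF FS cN N1 PS] unfolding cS of_nat_add of_nat_numeral by blast
  have finD: "finite D" using D(1) by (rule finite_subset) (simp add: S_def)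
  define C where "C = (\<lambda>d::int. {real_of_int (d - 2) / real M..<real_of_int (d + 3) / real M})"
  define E where "E = {0..<1} - (\<Union>d\<in>D. C d)"
  have "emeasure lebesgue ({0..<1} - E) \<le> emeasure lebesgue (\<Union>d\<in>D. C d)"
    by (rule emeasure_mono) (use finD in \<open>auto simp: E_def C_def\<close>)
  also have "\<dots> \<le> (\<Sum>d\<in>D. emeasure lebesgue (C d))"
    by (rule emeasure_subadditive_finite) (use finD in \<open>auto simp: C_def\<close>)
  also have "\<dots> = (\<Sum>d\<in>D. ennreal (5 / real M))"
    using M0 by (intro sum.cong) (auto simp: C_def field_simps)
  also have "\<dots> = ennreal (5 / real M * real (card D))"
    by (simp add: ennreal_of_nat_eq_real_of_nat mult.commute flip: ennreal_mult)
  also have "\<dots> \<le> ennreal (5 / real M * ((real M + 4) / real (card F) * ln (real N) + 1))"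
    by (intro ennreal_leI mult_left_mono D) simp
  finally have meas: "emeasure lebesgue ({0..<1} - E) \<le>
    ennreal (5 / real M * ((real M + 4) / real (card F) * ln (real N) + 1))" .
  have "\<not> (\<lambda>a. x + t * a) ` F \<subseteq> E" if t: "1 / real k \<le> \<bar>t\<bar>" "\<bar>t\<bar> \<le> real k" for x t
  proof
    assume xt: "(\<lambda>a. x + t * a) ` F \<subseteq> E"
    define i where "i = \<lfloor>x * real M\<rfloor>"
    define j where "j = \<lfloor>t * real M * real R\<rfloor>"
    have in01: "0 \<le> x + t * a" "x + t * a < 1" if "a \<in> F" for a
      using xt that by (auto simp: E_def)
    \<comment> \<open>Since \<open>\<bar>a\<bar> \<le> R\<close>, rounding \<open>j\<close> moves
      the image of \<open>a\<close> by at most one cell; rounding \<open>x\<close> and the floors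
      cost the rest.\<close>
    have near: "\<bar>\<lfloor>(x + t * a) * real M\<rfloor> - (i + \<lfloor>real_of_int j * a / real R\<rfloor>)\<bar> \<le> 2"
      if "a \<in> F" for a
    proof -
      have "t * real M * real R - real_of_int j \<in> {0..1}" by (simp add: j_def) linarith
      then have "\<bar>t * real M * real R - real_of_int j\<bar> * \<bar>a\<bar> \<le> 1 * real R"
        using FR[OF that] by (intro mult_mono) auto
      moreover have "(t * a * real M - real_of_int j * a / real R) * real R
          = (t * real M * real R - real_of_int j) * a"
        using R by (simp add: field_simps)
      then have "\<bar>t * a * real M - real_of_int j * a / real R\<bar> * real R
          = \<bar>t * real M * real R - real_of_int j\<bar> * \<bar>a\<bar>"
        by (metis abs_mult abs_of_nat)
      ultimately have "\<bar>t * a * real M - real_of_int j * a / real R\<bar> * real R \<le> 1 * real R"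
        by linarith
      then have "\<bar>t * a * real M - real_of_int j * a / real R\<bar> \<le> 1"
        by (rule mult_right_le_imp_le) (use R in simp)
      then show ?thesis unfolding i_def by (simp add: algebra_simps) linarith
    qed
    have inS: "pat i j \<subseteq> S"
    proof
      fix p assume "p \<in> pat i j"
      then obtain a where a: "a \<in> F" "p = i + \<lfloor>real_of_int j * a / real R\<rfloor>" by (auto simp: pat_def)
      have "0 \<le> (x + t * a) * real M" "(x + t * a) * real M < real M"
        using in01[OF a(1)] M0 by auto
      then have "0 \<le> \<lfloor>(x + t * a) * real M\<rfloor>" "\<lfloor>(x + t * a) * real M\<rfloor> < int M" by linarith+
      with near[OF a(1)] a(2) show "p \<in> S" unfolding S_def atLeastAtMost_iff by linarith
    qed
    \<comment> \<open>This is where the size of \<open>M\<close> enters: even after rounding, and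
      for the smallest dilation \<open>1 / k\<close>, points at distance \<open>g\<close> are spread
      at least one cell apart. Distinct points therefore get distinct cells.\<close>
    have jbig: "\<bar>real_of_int j\<bar> * g \<ge> real R"
    proof -
      have "real M * real R / real k \<le> \<bar>t\<bar> * real M * real R"
        using mult_right_mono[OF t(1), of "real M * real R"] by (simp add: mult_ac)
      then have 1: "\<bar>real_of_int j\<bar> \<ge> real M * real R / real k - 1"
      proof -
        have "\<bar>t * real M * real R\<bar> = \<bar>t\<bar> * real M * real R" by (simp add: abs_mult)
        moreover have "\<bar>real_of_int j\<bar> \<ge> \<bar>t * real M * real R\<bar> - 1" unfolding j_def by linarith
        ultimately show ?thesis using \<open>real M * real R / real k \<le> \<bar>t\<bar> * real M * real R\<close> by linarith
      qed
      have "real M / real k \<ge> 1 / g + 1" using M k by (simp add: field_simps)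
      from mult_right_mono[OF this, of "real R"]
      have "real M * real R / real k - 1 \<ge> real R / g" using R by (simp add: algebra_simps)
      with 1 have "\<bar>real_of_int j\<bar> \<ge> real R / g" by linarith
      then show ?thesis using g by (simp add: field_simps)
    qed
    have "inj_on (\<lambda>a. i + \<lfloor>real_of_int j * a / real R\<rfloor>) F"
    proof (rule inj_onI, rule ccontr)
      fix a b assume ab: "a \<in> F" "b \<in> F" "a \<noteq> b"
        "i + \<lfloor>real_of_int j * a / real R\<rfloor> = i + \<lfloor>real_of_int j * b / real R\<rfloor>"
      have "real_of_int j * (a - b) = (real_of_int j * a / real R - real_of_int j * b / real R) * real R"
        using R by (simp add: field_simps)
      then have "\<bar>real_of_int j\<bar> * \<bar>a - b\<bar> = \<bar>real_of_int j * a / real R - real_of_int j * b / real R\<bar> * real R"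
        by (metis abs_mult abs_of_nat)
      moreover have "real R \<le> \<bar>real_of_int j\<bar> * \<bar>a - b\<bar>"
        using jbig mult_left_mono[OF gap[OF ab(1-3)], of "\<bar>real_of_int j\<bar>"] by linarith
      ultimately have "1 * real R \<le> \<bar>real_of_int j * a / real R - real_of_int j * b / real R\<bar> * real R"
        by linarith
      then have "1 \<le> \<bar>real_of_int j * a / real R - real_of_int j * b / real R\<bar>"
        by (rule mult_right_le_imp_le) (use R in simp)
      with ab(4) show False by linarith
    qed
    then have card: "card (pat i j) = card F" unfolding pat_def by (rule card_image)
    have "j \<in> J"
    proof -
      have "\<bar>t\<bar> * (real M * real R) \<le> real k * (real M * real R)"
        using t by (intro mult_right_mono) auto
      then have "\<bar>t * real M * real R\<bar> \<le> real (k * M * R)" by (simp add: abs_mult)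
      then show ?thesis unfolding j_def J_def by (simp del: of_nat_mult) linarith
    qed
    moreover have "i \<in> I"
    proof -
      obtain a where a: "a \<in> F" using ne by auto
      have "\<bar>t * a\<bar> \<le> real k * real R" using t FR[OF a] by (simp add: abs_mult mult_mono)
      with in01[OF a] have "\<bar>x\<bar> \<le> 1 + real k * real R" by linarith
      from mult_right_mono[OF this, of "real M"]
      have "\<bar>x * real M\<bar> \<le> real (M * (1 + k * R))" by (simp add: abs_mult algebra_simps)
      then show ?thesis unfolding i_def I_def by (simp del: of_nat_mult) linarith
    qed
    ultimately have "pat i j \<in> \<F>" using inS card by (auto simp: \<F>_def)
    then have "pat i j \<inter> D \<noteq> {}" using D(3) by blast
    then obtain a where a: "a \<in> F" "i + \<lfloor>real_of_int j * a / real R\<rfloor> \<in> D"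
      unfolding pat_def by blast
    define d where "d = i + \<lfloor>real_of_int j * a / real R\<rfloor>"
    have "d - 2 \<le> \<lfloor>(x + t * a) * real M\<rfloor>" "\<lfloor>(x + t * a) * real M\<rfloor> < d + 3"
      using near[OF a(1)] unfolding d_def by linarith+
    then have "real_of_int (d - 2) \<le> (x + t * a) * real M" "(x + t * a) * real M < real_of_int (d + 3)"
      by linarith+
    then have "x + t * a \<in> C d" using M0 by (simp add: C_def field_simps)
    moreover have "x + t * a \<in> E" using xt a by auto
    ultimately show False using a unfolding E_def d_def by blast
  qed
  moreover have "E \<in> sets lebesgue" unfolding E_def C_def using finD by auto
  moreover have "E \<subseteq> {0..<1}" by (auto simp: E_def)
  ultimately show ?thesis using meas unfolding N_def by blast
qed

section \<open>Subexponential separation excludes universality\<close>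

text \<open>The gap is measured against the cardinality of \<open>F\<close> itself. The bound
  \<open>N\<close> rules out trivial witnesses such as the empty set and singletons.\<close>

definition subexp_separated :: "real set \<Rightarrow> bool" where
  "subexp_separated A \<longleftrightarrow> (\<forall>\<epsilon>>0. \<forall>N. \<exists>F\<subseteq>A. finite F \<and> N \<le> card F \<and>
     (\<forall>a\<in>F. \<forall>b\<in>F. a \<noteq> b \<longrightarrow> exp (- (\<epsilon> * real (card F))) \<le> \<bar>a - b\<bar>))"

text \<open>With \<open>M\<close> of order \<open>exp (\<epsilon> n)\<close>, the number of patterns
  has logarithm at most \<open>c + 2 \<epsilon> n\<close>, so the deleted measure is at most
  \<open>(25 c + 5) / n + 50 \<epsilon>\<close>. The choice \<open>\<epsilon> = \<eta> / 100\<close>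
  turns the last term into \<open>\<eta> / 2\<close>.\<close>

lemma avoiding_set_small:
  fixes A :: "real set" and k R :: nat and \<eta> :: real
  assumes A: "subexp_separated A" and R: "R > 0" and AR: "\<And>a. a \<in> A \<Longrightarrow> \<bar>a\<bar> \<le> real R"
    and k: "k > 0" and \<eta>: "\<eta> > 0"
  shows "\<exists>E. E \<in> sets lebesgue \<and> E \<subseteq> {0..<1} \<and>
    emeasure lebesgue ({0..<1} - E) \<le> ennreal \<eta> \<and>
    (\<forall>x t. 1 / real k \<le> \<bar>t\<bar> \<and> \<bar>t\<bar> \<le> real k \<longrightarrow> \<not> (\<lambda>a. x + t * a) ` A \<subseteq> E)"
proof -
  define \<epsilon> where "\<epsilon> = \<eta> / 100"
  \<comment> \<open>The constants \<open>b\<close> and \<open>m\<close> depend on \<open>k\<close>,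
    \<open>R\<close> and \<open>\<epsilon>\<close> but not on \<open>n\<close>. They serve in
    \<open>N \<le> b * real M ^ 2\<close> and
    \<open>real M \<le> exp (\<epsilon> * real n) * m\<close>.\<close>
  define b where "b = real ((2 * k * R + 3) * (2 * (1 + k * R) + 3))"
  define m where "m = 2 * real k + 1 + 1 / \<epsilon>"
  have \<epsilon>: "\<epsilon> > 0" using \<eta> by (simp add: \<epsilon>_def)
  have m1: "m \<ge> 1" using \<epsilon> by (simp add: m_def)
  have "1 \<le> (2 * k * R + 3) * (2 * (1 + k * R) + 3)" by simp
  then have b1: "b \<ge> 1" unfolding b_def by linarith
  define c where "c = ln b + 2 * ln m"
  \<comment> \<open>This many points make \<open>(25 c + 5) / n\<close> at most
    \<open>\<eta> / 2\<close>.\<close>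
  obtain F where F: "F \<subseteq> A" "finite F" "nat \<lceil>(50 * c + 10) / \<eta>\<rceil> + 1 \<le> card F"
    "\<And>a b. a \<in> F \<Longrightarrow> b \<in> F \<Longrightarrow> a \<noteq> b \<Longrightarrow> exp (- (\<epsilon> * real (card F))) \<le> \<bar>a - b\<bar>"
    using A \<epsilon> unfolding subexp_separated_def by meson
  define n where "n = card F"
  have n: "real n \<ge> (50 * c + 10) / \<eta>" "n > 0" using F(3) unfolding n_def by linarith+
  define g where "g = exp (- (\<epsilon> * real n))"
  \<comment> \<open>The first summand separates the cells; the summand \<open>n\<close> ensures
    \<open>card F \<le> M\<close>.\<close>
  define M where "M = nat \<lceil>real k * (1 / g + 1)\<rceil> + n"
  have g: "g > 0" "1 / g = exp (\<epsilon> * real n)" by (simp_all add: g_def exp_minus field_simps)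
  have M: "real M \<ge> real k * (1 / g + 1)" "M \<ge> n"
    unfolding M_def by (simp_all add: add_increasing2 real_nat_ceiling_ge)
  have Mn: "real M \<ge> real n" "real n \<ge> 1" using M n by auto
  have "real M \<le> real k * (exp (\<epsilon> * real n) + 1) + 1 + real n"
  proof -
    have "real k * (1 / g + 1) \<ge> 0" using g by simp
    then show ?thesis unfolding M_def g(2) by linarith
  qed
  also have "\<dots> \<le> exp (\<epsilon> * real n) * m"
  proof -
    have e1: "exp (\<epsilon> * real n) \<ge> 1" using \<epsilon> by simp
    have "\<epsilon> * real n \<le> exp (\<epsilon> * real n)" using exp_ge_add_one_self[of "\<epsilon> * real n"] by linarith
    then have "real n \<le> exp (\<epsilon> * real n) / \<epsilon>" using \<epsilon> by (simp add: field_simps)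
    moreover have "real k \<le> real k * exp (\<epsilon> * real n)"
      using mult_left_mono[OF e1, of "real k"] by simp
    ultimately have "real k * exp (\<epsilon> * real n) + real k + 1 + real n \<le>
        2 * (real k * exp (\<epsilon> * real n)) + exp (\<epsilon> * real n) + exp (\<epsilon> * real n) / \<epsilon>"
      using e1 by linarith
    then show ?thesis by (simp add: m_def distrib_left mult_ac)
  qed
  finally have Mm: "real M \<le> exp (\<epsilon> * real n) * m" .
  have Mpos: "real M > 0" using Mn by linarith
  have lnM: "ln (real M) \<le> \<epsilon> * real n + ln m"
    using ln_mono[OF Mm] Mpos m1 by (simp add: ln_mult)
  define N where "N = real ((2 * k * M * R + 3) * (2 * M * (1 + k * R) + 3))"
  have "N \<le> b * real M ^ 2"
  proof -
    have "2 * k * M * R + 3 \<le> (2 * k * R + 3) * M" "2 * M * (1 + k * R) + 3 \<le> (2 * (1 + k * R) + 3) * M"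
      using Mpos by (simp_all add: algebra_simps)
    from mult_le_mono[OF this]
    have "real ((2 * k * M * R + 3) * (2 * M * (1 + k * R) + 3)) \<le>
      real ((2 * k * R + 3) * M * ((2 * (1 + k * R) + 3) * M))" by (rule of_nat_mono)
    then show ?thesis unfolding N_def b_def power2_eq_square by (simp only: of_nat_mult mult_ac)
  qed
  moreover have "1 \<le> (2 * k * M * R + 3) * (2 * M * (1 + k * R) + 3)" by simp
  then have Nge: "N \<ge> 1" unfolding N_def by linarith
  ultimately have "ln N \<le> ln (b * real M ^ 2)" by simp
  also have "\<dots> = ln b + 2 * ln (real M)" using b1 Mpos by (simp add: ln_mult ln_realpow)
  finally have lnN: "ln N \<le> c + 2 * \<epsilon> * real n" using lnM by (simp add: c_def)
  have "5 / real M * ((real M + 4) / real n * ln N + 1) \<le>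
      5 / real M * (5 * real M / real n * ln N + real M / real n)"
    using Mn Nge by (intro mult_left_mono add_mono mult_right_mono divide_right_mono) (auto simp: field_simps)
  also have "\<dots> = (25 * ln N + 5) / real n" using Mpos Mn by (simp add: field_simps)
  also have "\<dots> \<le> (25 * (c + 2 * \<epsilon> * real n) + 5) / real n"
    using lnN by (intro divide_right_mono) auto
  also have "\<dots> = (25 * c + 5) / real n + \<eta> / 2" using Mn by (simp add: \<epsilon>_def field_simps)
  also have "\<dots> \<le> \<eta>" using n \<eta> by (simp add: field_simps)
  finally have le: "5 / real M * ((real M + 4) / real n * ln N + 1) \<le> \<eta>" .
  have Fne: "F \<noteq> {}" using n by (auto simp: n_def)
  have FR: "\<bar>a\<bar> \<le> real R" if "a \<in> F" for a using F(1) AR that by blast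
  have gap: "g \<le> \<bar>a - b\<bar>" if "a \<in> F" "b \<in> F" "a \<noteq> b" for a b
    using F(4)[OF that] by (simp add: g_def n_def)
  obtain E where E: "E \<in> sets lebesgue" "E \<subseteq> {0..<1}"
    "emeasure lebesgue ({0..<1} - E) \<le> ennreal (5 / real M * ((real M + 4) / real n * ln N + 1))"
    "\<forall>x t. 1 / real k \<le> \<bar>t\<bar> \<and> \<bar>t\<bar> \<le> real k \<longrightarrow> \<not> (\<lambda>a. x + t * a) ` F \<subseteq> E"
    using avoiding_set[OF F(2) Fne k R g(1) FR gap M(1) M(2)[unfolded n_def]]
    unfolding N_def[symmetric] n_def[symmetric] by blast
  show ?thesis
  proof (intro exI[of _ E] conjI allI impI)
    show "emeasure lebesgue ({0..<1} - E) \<le> ennreal \<eta>"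
      using E(3) ennreal_leI[OF le] by (rule order_trans)
    fix x t assume "1 / real k \<le> \<bar>t\<bar> \<and> \<bar>t\<bar> \<le> real k"
    with E(4) have "\<not> (\<lambda>a. x + t * a) ` F \<subseteq> E" by blast
    then show "\<not> (\<lambda>a. x + t * a) ` A \<subseteq> E" using F(1) by blast
  qed (use E in auto)
qed

lemma subexp_separated_not_universal:
  assumes A: "subexp_separated A" and "bounded A"
  shows "\<not> measure_universal A"
proof
  assume univ: "measure_universal A"
  from \<open>bounded A\<close> obtain r where r: "\<And>a. a \<in> A \<Longrightarrow> \<bar>a\<bar> \<le> r" by (auto simp: bounded_iff)
  define R where "R = nat \<lceil>r\<rceil> + 1"
  have "r \<le> real R" "R > 0" unfolding R_def by linarith+
  then have R: "R > 0" "\<And>a. a \<in> A \<Longrightarrow> \<bar>a\<bar> \<le> real R" using r by force+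
  define avoids where "avoids = (\<lambda>k E. \<forall>x t. 1 / real (Suc k) \<le> \<bar>t\<bar> \<and> \<bar>t\<bar> \<le> real (Suc k) \<longrightarrow>
    \<not> (\<lambda>a. x + t * a) ` A \<subseteq> E)"
  \<comment> \<open>The allowances 1/4, 1/8, ... sum to 1/2, so the intersection keeps positive
    measure, and every nonzero \<open>t\<close> falls into one of the ranges.\<close>
  have "\<forall>k. \<exists>E. E \<in> sets lebesgue \<and> E \<subseteq> {0..<1} \<and>
      emeasure lebesgue ({0..<1} - E) \<le> ennreal ((1/2) ^ Suc k / 2) \<and> avoids k E"
    unfolding avoids_def by (intro allI avoiding_set_small[OF A R]) simp_all
  then obtain E where E: "\<And>k. E k \<in> sets lebesgue" "\<And>k. E k \<subseteq> {0..<1}"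
    "\<And>k. emeasure lebesgue ({0..<1} - E k) \<le> ennreal ((1/2) ^ Suc k / 2)" "\<And>k. avoids k (E k)"
    by metis
  define L where "L = (\<Inter>k. E k)"
  have L: "L \<in> sets lebesgue" unfolding L_def by (rule sets.countable_INT) (use E in auto)
  have dsets: "{0..<1} - E k \<in> sets lebesgue" for k using E by auto
  have "{0..<1} - L = (\<Union>k. {0..<1} - E k)" by (auto simp: L_def)
  then have "emeasure lebesgue ({0..<1} - L) \<le> (\<Sum>k. emeasure lebesgue ({0..<1} - E k))"
    using emeasure_subadditive_countably[of "\<lambda>k. {0..<1} - E k" lebesgue] dsets by auto
  also have "\<dots> \<le> (\<Sum>k. ennreal ((1/2) ^ Suc k / 2))" by (intro suminf_le E) auto
  also have "\<dots> = ennreal (1 / 2)"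
    by (rule suminf_ennreal_eq) (use sums_divide[OF power_half_series, of 2] in auto)
  finally have small: "emeasure lebesgue ({0..<1} - L) \<le> ennreal (1 / 2)" .
  have "emeasure lebesgue L > 0"
  proof (rule ccontr)
    assume "\<not> ?thesis"
    then have "emeasure lebesgue L = 0" by simp
    have "ennreal 1 = emeasure lebesgue {0..<1::real}" by simp
    also have "\<dots> \<le> emeasure lebesgue (({0..<1} - L) \<union> L)"
      by (rule emeasure_mono) (use L in auto)
    also have "\<dots> \<le> emeasure lebesgue ({0..<1} - L) + emeasure lebesgue L"
      by (rule emeasure_subadditive) (use L in auto)
    also have "\<dots> \<le> ennreal (1 / 2)" using small \<open>emeasure lebesgue L = 0\<close> by simp
    finally show False by (subst (asm) ennreal_le_iff) auto
  qed
  with univ L obtain x t where t: "t \<noteq> 0" "(\<lambda>a. x + t * a) ` A \<subseteq> L"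
    unfolding measure_universal_def by blast
  define k where "k = nat \<lceil>max \<bar>t\<bar> (1 / \<bar>t\<bar>)\<rceil>"
  have "max \<bar>t\<bar> (1 / \<bar>t\<bar>) \<le> real (Suc k)" unfolding k_def by linarith
  then have "\<bar>t\<bar> \<le> real (Suc k)" "1 / real (Suc k) \<le> \<bar>t\<bar>" using t(1) by (auto simp: field_simps)
  with E(4)[of k] have "\<not> (\<lambda>a. x + t * a) ` A \<subseteq> E k" unfolding avoids_def by blast
  with t(2) show False by (auto simp: L_def)
qed

text \<open>A bounded interval contains no nonzero dilate of an unbounded set. This settles sumsets
  with an unbounded \<open>A\<close>.\<close>

lemma unbounded_not_universal:
  assumes "\<not> bounded A"
  shows "\<not> measure_universal A"
proof
  assume "measure_universal A"
  moreover have "{0..1::real} \<in> sets lebesgue" "emeasure lebesgue {0..1::real} > 0" by auto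
  ultimately obtain x t where t: "t \<noteq> 0" "(\<lambda>a. x + t * a) ` A \<subseteq> {0..1}"
    unfolding measure_universal_def by blast
  have "\<bar>a\<bar> \<le> (1 + \<bar>x\<bar>) / \<bar>t\<bar>" if "a \<in> A" for a
  proof -
    have "x + t * a \<in> {0..1}" using t that by auto
    then have "\<bar>t * a\<bar> \<le> 1 + \<bar>x\<bar>" by auto
    then show ?thesis using t(1) by (simp add: abs_mult field_simps)
  qed
  then have "bounded A" unfolding bounded_iff real_norm_def by blast
  with assms show False by simp
qed

section \<open>Separation of sumsets and of powers of two\<close>

text \<open>Two elements of \<open>Q\<close> differ by at most \<open>d\<close>, which cannot cancel
  more than half of a gap \<open>2 * d\<close> in \<open>P\<close>. Sums with the same summand from
  \<open>P\<close> inherit the gap of \<open>Q\<close>.\<close>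

lemma separated_set_plus:
  fixes P Q :: "real set" and d e :: real
  assumes "finite P" "finite Q" and e: "0 < e" "e \<le> d"
    and P: "\<And>p p'. p \<in> P \<Longrightarrow> p' \<in> P \<Longrightarrow> p \<noteq> p' \<Longrightarrow> 2 * d \<le> \<bar>p - p'\<bar>"
    and Qd: "Q \<subseteq> {0..d}"
    and Q: "\<And>q q'. q \<in> Q \<Longrightarrow> q' \<in> Q \<Longrightarrow> q \<noteq> q' \<Longrightarrow> e \<le> \<bar>q - q'\<bar>"
  shows "card (P + Q) = card P * card Q"
    and "\<And>u v. u \<in> P + Q \<Longrightarrow> v \<in> P + Q \<Longrightarrow> u \<noteq> v \<Longrightarrow> e \<le> \<bar>u - v\<bar>"
proof -
  have gap: "e \<le> \<bar>(p + q) - (p' + q')\<bar>"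
    if "p \<in> P" "q \<in> Q" "p' \<in> P" "q' \<in> Q" "(p, q) \<noteq> (p', q')" for p q p' q'
  proof (cases "p = p'")
    case True
    then show ?thesis using that Q[of q q'] by simp
  next
    case False
    have "q \<in> {0..d}" "q' \<in> {0..d}" using that Qd by auto
    with P[OF that(1,3) False] e show ?thesis by auto
  qed
  have "inj_on (\<lambda>(p, q). p + q) (P \<times> Q)"
    by (rule inj_onI) (use gap e in \<open>clarsimp, fastforce\<close>)
  then show "card (P + Q) = card P * card Q"
    by (simp add: set_plus_image card_image card_cartesian_product)
  show "e \<le> \<bar>u - v\<bar>" if "u \<in> P + Q" "v \<in> P + Q" "u \<noteq> v" for u v
    using that gap by (elim set_plus_elim) blast
qed

text \<open>Exponents at least 1 apart differ by a factor of at least 2, so the difference is at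
  least half of the larger power.\<close>

lemma two_powr_gap:
  fixes u v T :: real
  assumes "1 \<le> \<bar>u - v\<bar>" "u \<le> T" "v \<le> T"
  shows "2 powr (- T - 1) \<le> \<bar>2 powr (- u) - 2 powr (- v)\<bar>"
proof -
  have *: "2 powr (- T - 1) \<le> 2 powr (- u) - 2 powr (- v)" if "u + 1 \<le> v" "u \<le> T" for u v :: real
  proof -
    have "2 powr (- v) \<le> 2 powr (- u - 1)" using that by simp
    moreover have "2 powr (- u - 1) + 2 powr (- u - 1) = (2::real) powr (- u)"
      by (simp add: powr_diff)
    moreover have "2 powr (- T - 1) \<le> 2 powr (- u - 1)" using that by simp
    ultimately show ?thesis by linarith
  qed
  show ?thesis using *[of u v] *[of v u] assms by linarith
qed

lemma two_powr_image:
  fixes f :: "'a \<Rightarrow> real"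
  assumes f: "\<And>i j. i \<in> I \<Longrightarrow> j \<in> I \<Longrightarrow> i \<noteq> j \<Longrightarrow> 1 \<le> \<bar>f i - f j\<bar>"
    and T: "\<And>i. i \<in> I \<Longrightarrow> f i \<le> T"
  defines "Q \<equiv> (\<lambda>i. 2 powr (- f i)) ` I"
  shows "card Q = card I"
    and "\<And>q q'. q \<in> Q \<Longrightarrow> q' \<in> Q \<Longrightarrow> q \<noteq> q' \<Longrightarrow> 2 powr (- T - 1) \<le> \<bar>q - q'\<bar>"
proof -
  have gap: "2 powr (- T - 1) \<le> \<bar>2 powr (- f i) - 2 powr (- f j)\<bar>" if "i \<in> I" "j \<in> I" "i \<noteq> j" for i j
    using two_powr_gap f T that by blast
  have "inj_on (\<lambda>i. 2 powr (- f i)) I"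
  proof (rule inj_onI, rule ccontr)
    fix i j assume "i \<in> I" "j \<in> I" "2 powr (- f i) = 2 powr (- f j)" "i \<noteq> j"
    with gap[of i j] have "2 powr (- T - 1) \<le> (0::real)" by simp
    then show False by simp
  qed
  then show "card Q = card I" unfolding Q_def by (rule card_image)
  show "2 powr (- T - 1) \<le> \<bar>q - q'\<bar>" if "q \<in> Q" "q' \<in> Q" "q \<noteq> q'" for q q'
    using that gap unfolding Q_def by blast
qed

section \<open>Exponents at most one\<close>

text \<open>For \<open>\<alpha> \<le> 1\<close>, a unit step from
  \<open>y = k powr (1 / \<alpha>)\<close> raises the power by at most \<open>k / y \<le> 1\<close>,
  so rounding \<open>y\<close> up suffices.\<close>

lemma exists_nat_powr_near:
  fixes \<alpha> :: real and k :: nat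
  assumes "0 < \<alpha>" "\<alpha> \<le> 1" "k \<ge> 1"
  shows "\<exists>n\<ge>1::nat. real k \<le> real n powr \<alpha> \<and> real n powr \<alpha> \<le> real k + 1"
proof -
  define y where "y = real k powr (1 / \<alpha>)"
  define n where "n = nat \<lceil>y\<rceil>"
  have y1: "y \<ge> 1" using assms by (simp add: y_def ge_one_powr_ge_zero)
  have ya: "y powr \<alpha> = real k" using assms by (simp add: y_def powr_powr)
  have n: "y \<le> real n" "real n \<le> y + 1" using y1 unfolding n_def by linarith+
  have "real n powr \<alpha> \<le> (y + 1) powr \<alpha>" using n assms by (intro powr_mono2) auto
  also have "y + 1 = y * (1 + 1 / y)" using y1 by (simp add: distrib_left)
  also have "(y * (1 + 1 / y)) powr \<alpha> = y powr \<alpha> * (1 + 1 / y) powr \<alpha>"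
    by (rule powr_mult)
  also have "\<dots> \<le> y powr \<alpha> * (1 + 1 / y)"
    using y1 assms powr_mono[of \<alpha> 1 "1 + 1 / y"] by (intro mult_left_mono) auto
  also have "\<dots> \<le> real k + 1"
  proof -
    have "y powr \<alpha> \<le> y" using y1 assms powr_mono[of \<alpha> 1 y] by simp
    then show ?thesis using y1 by (simp add: ya field_simps)
  qed
  finally have "real n powr \<alpha> \<le> real k + 1" .
  moreover have "real k \<le> real n powr \<alpha>"
    unfolding ya[symmetric] using n y1 assms by (intro powr_mono2) auto
  moreover have "n \<ge> 1" using n y1 by linarith
  ultimately show ?thesis by blast
qed

lemma finite_set_min_gap:
  fixes P :: "real set"
  assumes "finite P"
  obtains g where "g > 0" "\<And>p p'. p \<in> P \<Longrightarrow> p' \<in> P \<Longrightarrow> p \<noteq> p' \<Longrightarrow> g \<le> \<bar>p - p'\<bar>"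
proof -
  \<comment> \<open>The inserted 1 keeps the set nonempty when \<open>P\<close> has at most one
    point.\<close>
  let ?D = "insert 1 ((\<lambda>(p, p'). \<bar>p - p'\<bar>) ` (P \<times> P - Id))"
  have fin: "finite ?D" using assms by simp
  show thesis
  proof (rule that[of "Min ?D"])
    show "Min ?D > 0" using fin by (subst Min_gr_iff) auto
    fix p p' assume "p \<in> P" "p' \<in> P" "p \<noteq> p'"
    then have "\<bar>p - p'\<bar> \<in> ?D" by force
    with fin show "Min ?D \<le> \<bar>p - p'\<bar>" by (rule Min_le)
  qed
qed

lemma subexp_separated_pow_seq_set_plus_infinite:
  assumes \<alpha>: "0 < \<alpha>" "\<alpha> \<le> 1" and "infinite A"
  shows "subexp_separated (pow_seq_set \<alpha> + A)"
  unfolding subexp_separated_def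
proof (intro allI impI)
  fix \<epsilon> :: real and N :: nat
  assume \<epsilon>: "\<epsilon> > 0"
  \<comment> \<open>\<open>M\<close> is chosen after \<open>K\<close> points of \<open>A\<close>, so large that their minimal gap no longer matters.\<close>
  define K where "K = nat \<lceil>4 / \<epsilon>\<rceil> + 1"
  have K: "real K \<ge> 4 / \<epsilon>" "K \<ge> 1" unfolding K_def by linarith+
  obtain P where P: "finite P" "card P = K" "P \<subseteq> A"
    using infinite_arbitrarily_large[OF \<open>infinite A\<close>] by blast
  obtain g where g: "g > 0" "\<And>p p'. p \<in> P \<Longrightarrow> p' \<in> P \<Longrightarrow> p \<noteq> p' \<Longrightarrow> g \<le> \<bar>p - p'\<bar>"
    using finite_set_min_gap[OF P(1)] by blast
  \<comment> \<open>Indices beyond \<open>N0\<close> put \<open>Q\<close> inside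
    \<open>{0..g/2}\<close>, half of the minimal gap of \<open>P\<close>.\<close>
  obtain N0 where N0: "(1/2) ^ N0 < g / 2" using real_arch_pow_inv[of "g/2" "1/2"] g by auto
  define M where "M = N0 + N + 1"
  define I where "I = {N0+1..N0+M}"
  define T where "T = real (2 * (N0 + M) + 1)"
  \<comment> \<open>Exponents in \<open>[2k, 2k + 1]\<close> are at least 1 apart for different
    \<open>k\<close>. The implication inside the quantifier yields a total choice function with
    \<open>h k \<ge> 1\<close> also at \<open>k = 0\<close>.\<close>
  have "\<exists>n\<ge>1::nat. k \<ge> 1 \<longrightarrow> real (2 * k) \<le> real n powr \<alpha> \<and> real n powr \<alpha> \<le> real (2 * k) + 1" for k
    using exists_nat_powr_near[OF \<alpha>, of "2 * k"] by (cases "k \<ge> 1") auto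
  then obtain h :: "nat \<Rightarrow> nat" where h: "\<And>k. h k \<ge> 1"
    "\<And>k. k \<ge> 1 \<Longrightarrow> real (2 * k) \<le> real (h k) powr \<alpha> \<and> real (h k) powr \<alpha> \<le> real (2 * k) + 1"
    by metis
  define f where "f = (\<lambda>k. real (h k) powr \<alpha>)"
  define Q where "Q = (\<lambda>k. 2 powr (- f k)) ` I"
  have f: "2 * real k \<le> f k" "f k \<le> 2 * real k + 1" if "k \<in> I" for k
    using h(2)[of k] that by (auto simp: I_def f_def)
  have sep: "1 \<le> \<bar>f i - f j\<bar>" if "i \<in> I" "j \<in> I" "i \<noteq> j" for i j
    using f[OF that(1)] f[OF that(2)] that(3) by (cases i j rule: linorder_cases) auto
  have fT: "f i \<le> T" if "i \<in> I" for i using f[OF that] that by (auto simp: T_def I_def)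
  have small: "2 powr (- real N0) \<le> g / 2"
    using N0 by (simp add: powr_minus powr_realpow power_one_over inverse_eq_divide)
  have Qd: "Q \<subseteq> {0..g/2}"
  proof
    fix q assume "q \<in> Q"
    then obtain k where k: "k \<in> I" "q = 2 powr (- f k)" by (auto simp: Q_def)
    have "f k \<ge> real N0" using f[OF k(1)] k(1) by (auto simp: I_def)
    then have "q \<le> 2 powr (- real N0)" using k by simp
    moreover have "0 \<le> q" using k by simp
    ultimately show "q \<in> {0..g/2}" using small unfolding atLeastAtMost_iff by linarith
  qed
  have "2 powr (- T - 1) \<le> 2 powr (- real N0)" by (simp add: T_def)
  with small have e: "2 powr (- T - 1) \<le> g / 2" by linarith
  have Qfin: "finite Q" by (simp add: Q_def I_def)
  note two_powr_image[of I f T, folded Q_def]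
  then have Q: "card Q = M" "\<And>q q'. q \<in> Q \<Longrightarrow> q' \<in> Q \<Longrightarrow> q \<noteq> q' \<Longrightarrow> 2 powr (- T - 1) \<le> \<bar>q - q'\<bar>"
    using sep fT by (auto simp: I_def)
  have g': "\<And>p p'. p \<in> P \<Longrightarrow> p' \<in> P \<Longrightarrow> p \<noteq> p' \<Longrightarrow> 2 * (g / 2) \<le> \<bar>p - p'\<bar>" using g by simp
  note sum = separated_set_plus[OF P(1) Qfin _ e g' Qd Q(2)]
  have card: "card (P + Q) = K * M" using sum(1) P Q by simp
  \<comment> \<open>Here \<open>M \<ge> N0 + 1\<close> gives the factor 4, which
    \<open>K \<ge> 4 / \<epsilon>\<close> absorbs.\<close>
  have "T + 1 \<le> 4 * real M" by (simp add: T_def M_def)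
  also have "\<dots> \<le> \<epsilon> * real K * real M" using K \<epsilon> by (intro mult_right_mono) (auto simp: field_simps)
  finally have "T + 1 \<le> \<epsilon> * real (K * M)" by (simp add: mult.assoc)
  moreover have "ln 2 * (T + 1) \<le> 1 * (T + 1)"
    using ln_2_less_1 by (intro mult_right_mono) (auto simp: T_def)
  ultimately have "ln 2 * (T + 1) \<le> \<epsilon> * real (K * M)"
    unfolding mult_1 by (rule order_trans[rotated])
  then have "exp (- (\<epsilon> * real (card (P + Q)))) \<le> 2 powr (- T - 1)"
    by (simp add: card powr_def algebra_simps)
  then have "\<forall>u\<in>P + Q. \<forall>v\<in>P + Q. u \<noteq> v \<longrightarrow> exp (- (\<epsilon> * real (card (P + Q)))) \<le> \<bar>u - v\<bar>"
    using sum(2) by force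
  moreover have "N \<le> card (P + Q)"
    using mult_le_mono1[OF K(2), of M] by (simp add: card M_def)
  moreover have "P + Q \<subseteq> pow_seq_set \<alpha> + A"
    using P(3) h(1) by (subst add.commute, intro set_plus_mono2) (auto simp: Q_def f_def pow_seq_set_def)
  moreover have "finite (P + Q)" using P(1) Qfin by (rule finite_set_plus)
  ultimately show "\<exists>F\<subseteq>pow_seq_set \<alpha> + A. finite F \<and> N \<le> card F \<and>
     (\<forall>a\<in>F. \<forall>b\<in>F. a \<noteq> b \<longrightarrow> exp (- (\<epsilon> * real (card F))) \<le> \<bar>a - b\<bar>)" by blast
qed

section \<open>Exponents at least one\<close>

text \<open>Factor out \<open>x powr (\<alpha> - 1)\<close>, which is at least 1 and nondecreasing
  for \<open>x \<ge> 1\<close>.\<close>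

lemma powr_nat_gap:
  fixes n m :: nat and \<alpha> :: real
  assumes "1 \<le> \<alpha>" "1 \<le> n" "n < m"
  shows "real n powr \<alpha> + 1 \<le> real m powr \<alpha>"
proof -
  have split: "x powr \<alpha> = x * x powr (\<alpha> - 1)" if "x \<ge> 1" for x :: real
    using that by (simp add: powr_diff)
  have "real n powr \<alpha> + 1 \<le> real n * real n powr (\<alpha> - 1) + real n powr (\<alpha> - 1)"
    using assms ge_one_powr_ge_zero[of "real n" "\<alpha> - 1"] split[of "real n"] by simp
  also have "\<dots> = (real n + 1) * real n powr (\<alpha> - 1)" by (simp add: algebra_simps)
  also have "\<dots> \<le> real m * real m powr (\<alpha> - 1)"
    using assms by (intro mult_mono powr_mono2) auto
  also have "\<dots> = real m powr \<alpha>" using assms split[of "real m"] by simp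
  finally show ?thesis .
qed

lemma subexp_separated_pow_seq_set_plus:
  fixes \<alpha> \<beta> :: real
  assumes \<alpha>: "1 \<le> \<alpha>" and \<beta>: "1 \<le> \<beta>" and sum: "1 / \<alpha> + 1 / \<beta> > 1"
  shows "subexp_separated (pow_seq_set \<alpha> + pow_seq_set \<beta>)"
  unfolding subexp_separated_def
proof (intro allI impI)
  fix \<epsilon> :: real and N :: nat
  assume \<epsilon>: "\<epsilon> > 0"
  define \<gamma> where "\<gamma> = 1 / \<alpha> + 1 / \<beta> - 1"
  have \<gamma>: "\<gamma> > 0" using sum by (simp add: \<gamma>_def)
  \<comment> \<open>Chosen so that \<open>T' + 1 \<le> C * T\<close>, where \<open>T'\<close> bounds
    the exponents occurring in \<open>Q\<close>.\<close>
  define C where "C = 2 * 4 powr \<beta> + 1"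
  \<comment> \<open>The first entry yields \<open>N\<close> points; the second makes
    \<open>T powr \<gamma>\<close> large enough for
    \<open>C * T \<le> \<epsilon> * (T * T powr \<gamma> / 2)\<close>.\<close>
  define T where "T = max (2 * real N + 2) ((2 * C / \<epsilon>) powr (1 / \<gamma>))"
  have T2: "T \<ge> 2" "T \<ge> 2 * real N" by (auto simp: T_def)
  have C: "C > 0" by (simp add: C_def add_pos_pos)
  have "2 * C / \<epsilon> = ((2 * C / \<epsilon>) powr (1 / \<gamma>)) powr \<gamma>" using C \<epsilon> \<gamma> by (simp add: powr_powr)
  also have "\<dots> \<le> T powr \<gamma>" using \<gamma> by (intro powr_mono2) (auto simp: T_def)
  finally have T\<gamma>: "2 * C / \<epsilon> \<le> T powr \<gamma>" .
  define x where "x = T powr (1 / \<alpha>)"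
  \<comment> \<open>The shift by 2 makes the exponents of \<open>Q\<close> start at
    \<open>T + 2\<close>, so \<open>Q\<close> lies within half of the spacing
    \<open>2 powr (- T - 1)\<close> of \<open>P\<close>.\<close>
  define y where "y = (T + 2) powr (1 / \<beta>)"
  define p where "p = nat \<lfloor>x\<rfloor>"
  define q where "q = nat \<lceil>y\<rceil>"
  have x: "x \<ge> 1" "x powr \<alpha> = T" using T2 \<alpha> by (auto simp: x_def powr_powr ge_one_powr_ge_zero)
  have y: "y \<ge> 1" "y powr \<beta> = T + 2" using T2 \<beta> by (auto simp: y_def powr_powr ge_one_powr_ge_zero)
  have "\<lfloor>x\<rfloor> \<ge> 1" using x by simp
  then have "real p = real_of_int \<lfloor>x\<rfloor>" "p \<ge> 1" unfolding p_def by linarith+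
  then have p: "real p \<le> x" "x / 2 \<le> real p" "p \<ge> 1" by linarith+
  have q: "y \<le> real q" "real q \<le> 2 * y" "q \<ge> 1" using y unfolding q_def by linarith+
  \<comment> \<open>Indices in the block \<open>{q..<2*q}\<close> stay below \<open>4 * y\<close>,
    so their exponents are at most \<open>4 powr \<beta> * (T + 2)\<close>, and
    \<open>T + 2 \<le> 2 * T\<close>.\<close>
  define T' where "T' = 2 * 4 powr \<beta> * T"
  define f where "f = (\<lambda>i::nat. real i powr \<alpha>)"
  define h where "h = (\<lambda>i::nat. real i powr \<beta>)"
  define P where "P = (\<lambda>i. 2 powr (- f i)) ` {1..p}"
  define Q where "Q = (\<lambda>i. 2 powr (- h i)) ` {q..<2*q}"
  have "f i \<le> T" if "i \<in> {1..p}" for i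
    unfolding f_def x(2)[symmetric] using that p \<alpha> by (intro powr_mono2) auto
  moreover have "1 \<le> \<bar>f i - f j\<bar>" if "i \<in> {1..p}" "j \<in> {1..p}" "i \<noteq> j" for i j
    using powr_nat_gap[OF \<alpha>, of i j] powr_nat_gap[OF \<alpha>, of j i] that unfolding f_def
    by (cases i j rule: linorder_cases) auto
  moreover note two_powr_image[of "{1..p}" f T, folded P_def]
  ultimately have P: "card P = p"
     "\<And>u v. u \<in> P \<Longrightarrow> v \<in> P \<Longrightarrow> u \<noteq> v \<Longrightarrow> 2 powr (- T - 1) \<le> \<bar>u - v\<bar>" by auto
  have hT: "T + 2 \<le> h i" "h i \<le> T'" if "i \<in> {q..<2*q}" for i
  proof -
    show "T + 2 \<le> h i" unfolding h_def y(2)[symmetric] using that q y \<beta> by (intro powr_mono2) auto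
    have "h i \<le> (4 * y) powr \<beta>" unfolding h_def using that q \<beta> by (intro powr_mono2) auto
    also have "\<dots> = 4 powr \<beta> * (T + 2)" using y by (simp add: powr_mult)
    also have "\<dots> \<le> 4 powr \<beta> * (2 * T)" using T2 by (intro mult_left_mono) auto
    finally show "h i \<le> T'" by (simp add: T'_def mult_ac)
  qed
  moreover have "1 \<le> \<bar>h i - h j\<bar>" if "i \<in> {q..<2*q}" "j \<in> {q..<2*q}" "i \<noteq> j" for i j
    using powr_nat_gap[OF \<beta>, of i j] powr_nat_gap[OF \<beta>, of j i] that q unfolding h_def
    by (cases i j rule: linorder_cases) auto
  moreover note two_powr_image[of "{q..<2*q}" h T', folded Q_def]
  ultimately have Q: "card Q = q"
     "\<And>u v. u \<in> Q \<Longrightarrow> v \<in> Q \<Longrightarrow> u \<noteq> v \<Longrightarrow> 2 powr (- T' - 1) \<le> \<bar>u - v\<bar>" by auto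
  have "2 * 2 powr (- T - 2) = (2::real) powr (- T - 1)" by (simp add: powr_diff)
  with P(2) have P2: "\<And>u v. u \<in> P \<Longrightarrow> v \<in> P \<Longrightarrow> u \<noteq> v \<Longrightarrow> 2 * 2 powr (- T - 2) \<le> \<bar>u - v\<bar>" by simp
  have Qd: "Q \<subseteq> {0..2 powr (- T - 2)}" using hT(1) by (force simp: Q_def)
  have "T + 2 \<le> T'" using order_trans[OF hT[of q]] q by auto
  then have e: "2 powr (- T' - 1) \<le> (2::real) powr (- T - 2)" by simp
  have fin: "finite P" "finite Q" by (auto simp: P_def Q_def)
  note PQ = separated_set_plus[OF fin _ e P2 Qd Q(2)]
  have card: "card (P + Q) = p * q" using PQ(1) P Q by simp
  have "T powr (1 / \<beta>) \<le> y" unfolding y_def using T2 \<beta> by (intro powr_mono2) auto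
  then have "T powr (1 / \<beta>) \<le> real q" using q by linarith
  then have "(x / 2) * T powr (1 / \<beta>) \<le> real p * real q" using p by (intro mult_mono) auto
  moreover have "x * T powr (1 / \<beta>) = T * T powr \<gamma>"
    using T2 by (simp add: x_def \<gamma>_def powr_diff flip: powr_add)
  ultimately have pq: "T * T powr \<gamma> / 2 \<le> real (p * q)" by simp
  have "ln 2 * (T' + 1) \<le> 1 * (T' + 1)"
    using ln_2_less_1 T2 by (intro mult_right_mono) (auto simp: T'_def)
  also have "\<dots> \<le> C * T" using T2 by (simp add: T'_def C_def algebra_simps)
  also have "\<dots> \<le> \<epsilon> * (T * T powr \<gamma> / 2)"
    using T\<gamma> \<epsilon> T2 by (simp add: field_simps)
  also have "\<dots> \<le> \<epsilon> * real (p * q)" using pq \<epsilon> by (intro mult_left_mono) auto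
  finally have "exp (- (\<epsilon> * real (card (P + Q)))) \<le> 2 powr (- T' - 1)"
    by (simp add: card powr_def algebra_simps)
  then have "\<forall>u\<in>P + Q. \<forall>v\<in>P + Q. u \<noteq> v \<longrightarrow> exp (- (\<epsilon> * real (card (P + Q)))) \<le> \<bar>u - v\<bar>"
    using PQ(2) by force
  moreover have "N \<le> card (P + Q)"
  proof -
    have "1 \<le> T powr \<gamma>" using T2 \<gamma> by (simp add: ge_one_powr_ge_zero)
    then have "T / 2 \<le> T * T powr \<gamma> / 2" using T2 by simp
    with pq T2 have "real N \<le> real (p * q)" by linarith
    then show ?thesis unfolding card by linarith
  qed
  moreover have "P + Q \<subseteq> pow_seq_set \<alpha> + pow_seq_set \<beta>"
    using q(3) by (intro set_plus_mono2) (auto simp: P_def Q_def f_def h_def pow_seq_set_def)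
  moreover have "finite (P + Q)" using fin by (rule finite_set_plus)
  ultimately show "\<exists>F\<subseteq>pow_seq_set \<alpha> + pow_seq_set \<beta>. finite F \<and> N \<le> card F \<and>
     (\<forall>a\<in>F. \<forall>b\<in>F. a \<noteq> b \<longrightarrow> exp (- (\<epsilon> * real (card F))) \<le> \<bar>a - b\<bar>)" by blast
qed

section \<open>Combination of the two ranges of exponents\<close>

text \<open>This allows a sequence to serve as the infinite set \<open>A\<close> when the other
  exponent is at most 1.\<close>

lemma infinite_pow_seq_set:
  assumes "\<alpha> > 0"
  shows "infinite (pow_seq_set \<alpha>)"
proof -
  have "inj_on (\<lambda>n::nat. 2 powr (- (real n powr \<alpha>))) {1..}"
  proof (rule inj_onI)
    fix n m :: nat
    assume "2 powr (- (real n powr \<alpha>)) = 2 powr (- (real m powr \<alpha>))"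
    then have "real n powr \<alpha> = real m powr \<alpha>" by (simp add: powr_inj)
    then have "(real n powr \<alpha>) powr (1 / \<alpha>) = (real m powr \<alpha>) powr (1 / \<alpha>)" by simp
    then show "n = m" using assms by (simp add: powr_powr)
  qed
  then have "infinite ((\<lambda>n::nat. 2 powr (- (real n powr \<alpha>))) ` {1..})"
    by (simp add: finite_image_iff infinite_Ici)
  moreover have "(\<lambda>n::nat. 2 powr (- (real n powr \<alpha>))) ` {1..} = pow_seq_set \<alpha>"
    by (auto simp: pow_seq_set_def)
  ultimately show ?thesis by simp
qed

text \<open>The second and third conjuncts are the arithmetic behind the examples of admissible
  pairs.\<close>

theorem corollary7:
  fixes \<alpha>1 \<alpha>2 :: real
  assumes "\<alpha>1 > 0" and "\<alpha>2 > 0"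
  shows "(1 / \<alpha>1 + 1 / \<alpha>2 > 1 \<longrightarrow>
            \<not> measure_universal (pow_seq_set \<alpha>1 + pow_seq_set \<alpha>2)) \<and>
         (\<alpha>1 < 2 \<and> \<alpha>2 < 2 \<longrightarrow> 1 / \<alpha>1 + 1 / \<alpha>2 > 1) \<and>
         1 / (6 / 5) + 1 / 5 > (1 :: real) \<and>
         (\<alpha>1 \<le> 1 \<longrightarrow>
            (\<forall>A :: real set. infinite A \<longrightarrow> \<not> measure_universal (pow_seq_set \<alpha>1 + A)))"
proof -
  have sep: "\<not> measure_universal A" if "subexp_separated A" for A
    using that subexp_separated_not_universal unbounded_not_universal by blast
  have inf: "\<not> measure_universal (pow_seq_set \<alpha> + A)" if "0 < \<alpha>" "\<alpha> \<le> 1" "infinite A" for \<alpha> A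
    using that by (intro sep subexp_separated_pow_seq_set_plus_infinite)
  have "\<not> measure_universal (pow_seq_set \<alpha>1 + pow_seq_set \<alpha>2)" if "1 / \<alpha>1 + 1 / \<alpha>2 > 1"
  proof -
    \<comment> \<open>An exponent at most 1 is covered by the result for infinite sets, up to
      swapping the summands.\<close>
    consider "\<alpha>1 \<le> 1" | "\<alpha>2 \<le> 1" | "1 \<le> \<alpha>1" "1 \<le> \<alpha>2" by linarith
    then show ?thesis
    proof cases
      case 1
      with assms show ?thesis by (intro inf infinite_pow_seq_set)
    next
      case 2
      with assms show ?thesis by (subst add.commute) (intro inf infinite_pow_seq_set)
    next
      case 3
      with that show ?thesis by (intro sep subexp_separated_pow_seq_set_plus)
    qed
  qed
  moreover have "1 / \<alpha>1 + 1 / \<alpha>2 > 1" if "\<alpha>1 < 2" "\<alpha>2 < 2"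
  proof -
    have "1 / \<alpha>1 > 1 / 2" "1 / \<alpha>2 > 1 / 2" using that assms by (auto simp: field_simps)
    then show ?thesis by linarith
  qed
  ultimately show ?thesis using inf[OF assms(1)] by auto
qed

end
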